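(* Let $(\mathfrak g,\omega)$ be a symplectic Lie algebra and let $(\mathfrak b,\bar\omega)$ be its irreducible symplectic base. Then $(\mathfrak g,\omega)$ has a Lagrangian subalgebra if and only if $(\mathfrak b,\bar\omega)$ has a Lagrangian subalgebra.
   Context: All Lie algebras are finite-dimensional over a fixed field $k$ of characteristic $0$. A symplectic Lie algebra $(\mathfrak g,\omega)$ is a Lie algebra $\mathfrak g$ with a non-degenerate alternating form $\omega$ satisfying $\omega([u,v],w)+\omega([w,u],v)+\omega([v,w],u)=0$ for all $u,v,w$. For a subspace $W$, $W^{\perp_\omega}=\{v:\omega(v,w)=0\ \forall w\in W\}$; $W$ is isotropic if $W\subseteq W^{\perp_\omega}$ and Lagrangian if $W=W^{\perp_\omega}$. A Lagrangian subalgebra is a Lie subalgebra that is a Lagrangian subspace. If $\mathfrak j$ is an isotropic ideal of $(\mathfrak g,\omega)$, then $\mathfrak j^{\perp_\omega}$ is a subalgebra containing $\mathfrak j$ as an ideal, and $\omega$ induces a symplectic form on $\mathfrak j^{\perp_\omega}/\mathfrak j$; the resulting symplectic Lie algebra is the symplectic reduction of $(\mathfrak g,\omega)$ with respect to $\mathfrak j$. A symplectic Lie algebra is irreducible if it has no non-zero isotropic ideal. An irreducible symplectic base of $(\mathfrak g,\omega)$ is an irreducible symplectic Lie algebra which is the last term of a finite sequence of symplectic Lie algebras starting with $(\mathfrak g,\omega)$ in which each term is a symplectic reduction of the preceding one. Such a base exists and is unique up to isomorphism of symplectic Lie algebras, so one speaks of the irreducible base. *)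

theory Defs
  imports "Jordan_Normal_Form.Missing_VectorSpace" "HOL-Algebra.QuotRing"
begin

text \<open>Vector spaces are those of the AFP entry VectorSpace: \<open>vectorspace K V\<close> for a module
  record \<open>V\<close> over a field record \<open>K\<close>. The fields \<open>mult\<close> and \<open>one\<close>, which module records inherit
  from ring records, carry no meaning for vector spaces and are ignored throughout.\<close>

record ('a, 'b) lie_record = "('a, 'b) module" +
  bracket :: "'b \<Rightarrow> 'b \<Rightarrow> 'b"

record ('a, 'b) symplectic_record = "('a, 'b) lie_record" +
  form :: "'b \<Rightarrow> 'b \<Rightarrow> 'a"

locale lie_algebra = vectorspace K G
  for K :: "('a, 'k) ring_scheme" (structure) and G :: "('a, 'b, 'c) lie_record_scheme" +
  assumes char_0: "\<And>n::nat. n > 0 \<Longrightarrow> [n] \<cdot> \<one> \<noteq> \<zero>"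
    and finite_dimensional: "fin_dim"
    and bracket_closed: "\<lbrakk>u \<in> carrier G; v \<in> carrier G\<rbrakk> \<Longrightarrow> bracket G u v \<in> carrier G"
    and bracket_add_left: "\<lbrakk>u \<in> carrier G; v \<in> carrier G; w \<in> carrier G\<rbrakk> \<Longrightarrow>
      bracket G (u \<oplus>\<^bsub>G\<^esub> v) w = bracket G u w \<oplus>\<^bsub>G\<^esub> bracket G v w"
    and bracket_add_right: "\<lbrakk>u \<in> carrier G; v \<in> carrier G; w \<in> carrier G\<rbrakk> \<Longrightarrow>
      bracket G u (v \<oplus>\<^bsub>G\<^esub> w) = bracket G u v \<oplus>\<^bsub>G\<^esub> bracket G u w"
    and bracket_smult_left: "\<lbrakk>a \<in> carrier K; u \<in> carrier G; v \<in> carrier G\<rbrakk> \<Longrightarrow>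
      bracket G (a \<odot>\<^bsub>G\<^esub> u) v = a \<odot>\<^bsub>G\<^esub> bracket G u v"
    and bracket_smult_right: "\<lbrakk>a \<in> carrier K; u \<in> carrier G; v \<in> carrier G\<rbrakk> \<Longrightarrow>
      bracket G u (a \<odot>\<^bsub>G\<^esub> v) = a \<odot>\<^bsub>G\<^esub> bracket G u v"
    and bracket_self: "u \<in> carrier G \<Longrightarrow> bracket G u u = \<zero>\<^bsub>G\<^esub>"
    and jacobi: "\<lbrakk>u \<in> carrier G; v \<in> carrier G; w \<in> carrier G\<rbrakk> \<Longrightarrow>
      bracket G u (bracket G v w) \<oplus>\<^bsub>G\<^esub> bracket G v (bracket G w u)
        \<oplus>\<^bsub>G\<^esub> bracket G w (bracket G u v) = \<zero>\<^bsub>G\<^esub>"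

locale symplectic_lie_algebra = lie_algebra K G
  for K :: "('a, 'k) ring_scheme" (structure) and G :: "('a, 'b, 'c) symplectic_record_scheme" +
  assumes form_closed: "\<lbrakk>u \<in> carrier G; v \<in> carrier G\<rbrakk> \<Longrightarrow> form G u v \<in> carrier K"
    and form_add_left: "\<lbrakk>u \<in> carrier G; v \<in> carrier G; w \<in> carrier G\<rbrakk> \<Longrightarrow>
      form G (u \<oplus>\<^bsub>G\<^esub> v) w = form G u w \<oplus> form G v w"
    and form_add_right: "\<lbrakk>u \<in> carrier G; v \<in> carrier G; w \<in> carrier G\<rbrakk> \<Longrightarrow>
      form G u (v \<oplus>\<^bsub>G\<^esub> w) = form G u v \<oplus> form G u w"
    and form_smult_left: "\<lbrakk>a \<in> carrier K; u \<in> carrier G; v \<in> carrier G\<rbrakk> \<Longrightarrow>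
      form G (a \<odot>\<^bsub>G\<^esub> u) v = a \<otimes> form G u v"
    and form_smult_right: "\<lbrakk>a \<in> carrier K; u \<in> carrier G; v \<in> carrier G\<rbrakk> \<Longrightarrow>
      form G u (a \<odot>\<^bsub>G\<^esub> v) = a \<otimes> form G u v"
    and form_alternating: "u \<in> carrier G \<Longrightarrow> form G u u = \<zero>"
    and form_nondegenerate: "\<lbrakk>u \<in> carrier G; \<And>v. v \<in> carrier G \<Longrightarrow> form G u v = \<zero>\<rbrakk> \<Longrightarrow>
      u = \<zero>\<^bsub>G\<^esub>"
    and form_cocycle: "\<lbrakk>u \<in> carrier G; v \<in> carrier G; w \<in> carrier G\<rbrakk> \<Longrightarrow>
      form G (bracket G u v) w \<oplus> form G (bracket G w u) v \<oplus> form G (bracket G v w) u = \<zero>"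

definition lie_subalgebra ::
  "('a, 'k) ring_scheme \<Rightarrow> 'b set \<Rightarrow> ('a, 'b, 'c) lie_record_scheme \<Rightarrow> bool" where
  "lie_subalgebra K H G \<longleftrightarrow>
     VectorSpace.subspace K H G \<and> (\<forall>x\<in>H. \<forall>y\<in>H. bracket G x y \<in> H)"

definition lie_ideal ::
  "('a, 'k) ring_scheme \<Rightarrow> 'b set \<Rightarrow> ('a, 'b, 'c) lie_record_scheme \<Rightarrow> bool" where
  "lie_ideal K J G \<longleftrightarrow>
     VectorSpace.subspace K J G \<and> (\<forall>x\<in>carrier G. \<forall>y\<in>J. bracket G x y \<in> J)"

definition form_perp ::
  "('a, 'k) ring_scheme \<Rightarrow> ('a, 'b, 'c) symplectic_record_scheme \<Rightarrow> 'b set \<Rightarrow> 'b set" where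
  "form_perp K G W = {v \<in> carrier G. \<forall>w\<in>W. form G v w = \<zero>\<^bsub>K\<^esub>}"

definition isotropic ::
  "('a, 'k) ring_scheme \<Rightarrow> 'b set \<Rightarrow> ('a, 'b, 'c) symplectic_record_scheme \<Rightarrow> bool" where
  "isotropic K W G \<longleftrightarrow> VectorSpace.subspace K W G \<and> W \<subseteq> form_perp K G W"

definition lagrangian ::
  "('a, 'k) ring_scheme \<Rightarrow> 'b set \<Rightarrow> ('a, 'b, 'c) symplectic_record_scheme \<Rightarrow> bool" where
  "lagrangian K W G \<longleftrightarrow> VectorSpace.subspace K W G \<and> W = form_perp K G W"

definition lagrangian_subalgebra ::
  "('a, 'k) ring_scheme \<Rightarrow> 'b set \<Rightarrow> ('a, 'b, 'c) symplectic_record_scheme \<Rightarrow> bool" where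
  "lagrangian_subalgebra K L G \<longleftrightarrow> lie_subalgebra K L G \<and> lagrangian K L G"

definition isotropic_ideal ::
  "('a, 'k) ring_scheme \<Rightarrow> 'b set \<Rightarrow> ('a, 'b, 'c) symplectic_record_scheme \<Rightarrow> bool" where
  "isotropic_ideal K J G \<longleftrightarrow> lie_ideal K J G \<and> isotropic K J G"

definition irreducible_symplectic ::
  "('a, 'k) ring_scheme \<Rightarrow> ('a, 'b, 'c) symplectic_record_scheme \<Rightarrow> bool" where
  "irreducible_symplectic K G \<longleftrightarrow>
     symplectic_lie_algebra K G \<and> (\<forall>J. isotropic_ideal K J G \<longrightarrow> J = {\<zero>\<^bsub>G\<^esub>})"

text \<open>The quotient of \<open>form_perp K G J\<close> by \<open>J\<close>, a set of cosets. Scalar multiplication and bracket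
  follow the pattern of \<^const>\<open>rcoset_mult\<close>: the union runs over all representatives. It is a
  single coset, and the set under \<^const>\<open>the_elem\<close> a singleton, when \<open>J\<close> is an isotropic ideal.\<close>

definition symplectic_quotient ::
  "('a, 'k) ring_scheme \<Rightarrow> ('a, 'b, 'c) symplectic_record_scheme \<Rightarrow> 'b set \<Rightarrow>
   ('a, 'b set) symplectic_record" where
  "symplectic_quotient K G J =
     \<lparr>carrier = a_rcosets\<^bsub>G\<lparr>carrier := form_perp K G J\<rparr>\<^esub> J,
      mult = (\<lambda>_ _. undefined), one = undefined,
      zero = J,
      add = (\<lambda>X Y. X <+>\<^bsub>G\<^esub> Y),
      smult = (\<lambda>a X. \<Union>x\<in>X. J +>\<^bsub>G\<^esub> (a \<odot>\<^bsub>G\<^esub> x)),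
      bracket = (\<lambda>X Y. \<Union>x\<in>X. \<Union>y\<in>Y. J +>\<^bsub>G\<^esub> bracket G x y),
      form = (\<lambda>X Y. the_elem {form G x y | x y. x \<in> X \<and> y \<in> Y})\<rparr>"

definition symplectic_iso ::
  "('a, 'k) ring_scheme \<Rightarrow> ('a, 'b, 'c) symplectic_record_scheme \<Rightarrow>
   ('a, 'd, 'e) symplectic_record_scheme \<Rightarrow> bool" where
  "symplectic_iso K G H \<longleftrightarrow>
     (\<exists>f. linear_map K G H f \<and> bij_betw f (carrier G) (carrier H) \<and>
        (\<forall>x\<in>carrier G. \<forall>y\<in>carrier G. f (bracket G x y) = bracket H (f x) (f y)) \<and>
        (\<forall>x\<in>carrier G. \<forall>y\<in>carrier G. form H (f x) (f y) = form G x y))"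

text \<open>Successive quotients have carriers in \<open>'b\<close>, \<open>'b set\<close>, \<open>'b set set\<close>, and so on. To keep a
  whole sequence of reductions in one type, being a reduction is understood up to isomorphism. This
  loses no sequence: choosing coset representatives gives every quotient of a subspace of \<open>G\<close> an
  isomorphic copy on a subset of \<open>'b\<close>.\<close>

definition symplectic_reduction ::
  "('a, 'k) ring_scheme \<Rightarrow> ('a, 'b) symplectic_record \<Rightarrow> ('a, 'd) symplectic_record \<Rightarrow> bool" where
  "symplectic_reduction K G H \<longleftrightarrow>
     (\<exists>J. isotropic_ideal K J G \<and> symplectic_iso K (symplectic_quotient K G J) H)"

definition irreducible_symplectic_base ::
  "('a, 'k) ring_scheme \<Rightarrow> ('a, 'b) symplectic_record \<Rightarrow> ('a, 'd) symplectic_record \<Rightarrow> bool" where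
  "irreducible_symplectic_base K G B \<longleftrightarrow>
     irreducible_symplectic K B \<and>
     (\<exists>H. (symplectic_reduction K)\<^sup>*\<^sup>* G H \<and> symplectic_iso K H B)"

end

theory Submission
  imports Defs
begin

text \<open>It suffices to compare \<open>G\<close> with one reduction \<open>p : J\<^sup>\<bottom> \<rightarrow> J\<^sup>\<bottom>/J\<close>. If \<open>L\<close> is a Lagrangian
  subalgebra of \<open>G\<close>, then \<open>p (L \<inter> J\<^sup>\<bottom>)\<close> is a subalgebra, and it is Lagrangian: a vector \<open>v\<close> of \<open>J\<^sup>\<bottom>\<close>
  orthogonal to \<open>L \<inter> J\<^sup>\<bottom> = (L + J)\<^sup>\<bottom>\<close> lies in \<open>(L + J)\<^sup>\<bottom>\<^sup>\<bottom> = L + J\<close>, so \<open>p v\<close> is in the image.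
  Conversely, the preimage of a Lagrangian subalgebra of the reduction contains \<open>J\<close>, hence its
  orthogonal lies in \<open>J\<^sup>\<bottom>\<close>, where it can be computed after applying \<open>p\<close>.\<close>

section \<open>Subspaces of a finite-dimensional space\<close>

lemma form_perpD: "\<lbrakk>u \<in> form_perp K G W; w \<in> W\<rbrakk> \<Longrightarrow> form G u w = \<zero>\<^bsub>K\<^esub>"
  by (simp add: form_perp_def)

lemma (in vectorspace) subspaceI:
  assumes "W \<subseteq> carrier V" "\<zero>\<^bsub>V\<^esub> \<in> W"
    and "\<And>v w. \<lbrakk>v \<in> W; w \<in> W\<rbrakk> \<Longrightarrow> v \<oplus>\<^bsub>V\<^esub> w \<in> W"
    and "\<And>a v. \<lbrakk>a \<in> carrier K; v \<in> W\<rbrakk> \<Longrightarrow> a \<odot>\<^bsub>V\<^esub> v \<in> W"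
  shows "subspace K W V"
  using assms by (intro subspace.intro submodule.intro vectorspace_axioms module_axioms) auto

lemma (in vectorspace) subspaceD:
  assumes "subspace K W V"
  shows "W \<subseteq> carrier V" "\<zero>\<^bsub>V\<^esub> \<in> W"
    and "\<And>v w. \<lbrakk>v \<in> W; w \<in> W\<rbrakk> \<Longrightarrow> v \<oplus>\<^bsub>V\<^esub> w \<in> W"
    and "\<And>a v. \<lbrakk>a \<in> carrier K; v \<in> W\<rbrakk> \<Longrightarrow> a \<odot>\<^bsub>V\<^esub> v \<in> W"
    and "\<And>v. v \<in> W \<Longrightarrow> \<ominus>\<^bsub>V\<^esub> v \<in> W"
proof -
  interpret submodule K W V using assms by (rule subspace.submod)
  show "W \<subseteq> carrier V" "\<zero>\<^bsub>V\<^esub> \<in> W"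
    and *: "\<And>v w. \<lbrakk>v \<in> W; w \<in> W\<rbrakk> \<Longrightarrow> v \<oplus>\<^bsub>V\<^esub> w \<in> W"
    and **: "\<And>a v. \<lbrakk>a \<in> carrier K; v \<in> W\<rbrakk> \<Longrightarrow> a \<odot>\<^bsub>V\<^esub> v \<in> W"
    using subset by auto
  show "\<ominus>\<^bsub>V\<^esub> v \<in> W" if "v \<in> W" for v
  proof -
    have "\<ominus>\<^bsub>V\<^esub> v = (\<ominus>\<^bsub>K\<^esub> \<one>\<^bsub>K\<^esub>) \<odot>\<^bsub>V\<^esub> v"
      using that subset by (auto simp: smult_l_minus)
    then show ?thesis using that by simp
  qed
qed

text \<open>A maximal independent subset of \<open>W\<close> does it. One exists because independent
  subsets of \<open>W\<close> have at most \<open>dim\<close> elements, with \<open>dim\<close> the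
  dimension of the ambient space.\<close>

lemma (in vectorspace) subspace_finitely_spanned:
  assumes "fin_dim" "subspace K W V"
  obtains S where "finite S" "S \<subseteq> W" "span S = W"
proof -
  have W: "W \<subseteq> carrier V" using assms(2) by (rule subspaceD)
  let ?P = "\<lambda>S. S \<subseteq> W \<and> lin_indpt S"
  have "?P {}" by (auto simp: lin_dep_def)
  moreover have "finite S \<and> card S \<le> dim" if "?P S" for S
    using li_le_dim[OF assms(1), of S] that W by auto
  ultimately obtain S where S: "finite S" "maximal S ?P"
    using maximal_exists[of ?P dim "{}"] by blast
  then have SW: "S \<subseteq> W" "lin_indpt S" by (auto simp: maximal_def)
  have "w \<in> span S" if w: "w \<in> W" for w
  proof (cases "w \<in> S")
    case True
    then show ?thesis using in_own_span SW W by blast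
  next
    case False
    then have "lin_dep (S \<union> {w})"
      using S(2) w SW(1) unfolding maximal_def by blast
    then show ?thesis using lin_dep_iff_in_span[of S w] SW W w False by auto
  qed
  moreover have "span S \<subseteq> W"
    using span_is_subset SW assms(2) by (simp add: subspace.submod)
  ultimately show ?thesis using that S SW by blast
qed

text \<open>Spans of subsets of \<open>W\<close> are the same in \<open>vs W\<close> as in the
  ambient space, so the finite spanning set serves for both. Used for the domain of the reduction
  projection.\<close>

lemma (in vectorspace) fin_dim_subspace:
  assumes "fin_dim" "subspace K W V"
  shows "vectorspace.fin_dim K (vs W)"
proof -
  interpret W: vectorspace K "vs W" using assms(2) by (rule subspace_is_vs)
  obtain S where "finite S" "S \<subseteq> W" "span S = W"
    using subspace_finitely_spanned assms .
  then show ?thesis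
    using span_li_not_depend(1)[of S W] assms(2)
    unfolding W.fin_dim_def by (auto simp: subspace.submod)
qed

section \<open>Antisymmetry of the bracket and two-sided ideals\<close>

context lie_algebra
begin

lemma bracket_antisym:
  assumes "u \<in> carrier G" "v \<in> carrier G"
  shows "bracket G u v = \<ominus>\<^bsub>G\<^esub> bracket G v u"
proof -
  have "bracket G u v \<oplus>\<^bsub>G\<^esub> bracket G v u = \<zero>\<^bsub>G\<^esub>"
    using bracket_add_left[of u v "u \<oplus>\<^bsub>G\<^esub> v"] assms
    by (simp add: bracket_add_right bracket_self bracket_closed)
  then show ?thesis
    using assms by (metis bracket_closed M.minus_equality)
qed

text \<open>\<open>lie_ideal\<close> constrains only brackets with the ideal element on the right;
  antisymmetry and closure under negation supply the other side.\<close>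

lemma lie_idealD:
  assumes "lie_ideal K J G" "x \<in> carrier G" "y \<in> J"
  shows "bracket G x y \<in> J" "bracket G y x \<in> J"
proof -
  have sub: "subspace K J G" using assms(1) by (simp add: lie_ideal_def)
  show *: "bracket G x y \<in> J" using assms by (simp add: lie_ideal_def)
  show "bracket G y x \<in> J"
    using bracket_antisym[of y x] subspaceD(1,5)[OF sub] * assms(2,3) by auto
qed

end

section \<open>Orthogonals under the symplectic form\<close>

context symplectic_lie_algebra
begin

lemma form_zero_left [simp]: "u \<in> carrier G \<Longrightarrow> form G \<zero>\<^bsub>G\<^esub> u = \<zero>"
  using form_smult_left[of \<zero> "\<zero>\<^bsub>G\<^esub>" u] by (simp add: form_closed)

lemma form_zero_right [simp]: "u \<in> carrier G \<Longrightarrow> form G u \<zero>\<^bsub>G\<^esub> = \<zero>"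
  using form_smult_right[of \<zero> u "\<zero>\<^bsub>G\<^esub>"] by (simp add: form_closed)

lemma form_antisym:
  assumes "u \<in> carrier G" "v \<in> carrier G"
  shows "form G u v = \<ominus> form G v u"
proof -
  have "form G u v \<oplus> form G v u = \<zero>"
    using form_add_left[of u v "u \<oplus>\<^bsub>G\<^esub> v"] assms
    by (simp add: form_add_right form_alternating form_closed)
  then show ?thesis
    using assms by (metis form_closed R.minus_equality)
qed

text \<open>\<open>form_perp\<close> puts its members in the left argument; this makes left and
  right orthogonals coincide.\<close>

lemma form_eq_zero_commute:
  assumes "u \<in> carrier G" "v \<in> carrier G"
  shows "form G u v = \<zero> \<longleftrightarrow> form G v u = \<zero>"
  using form_antisym[OF assms] form_antisym[OF assms(2,1)] by auto

lemma form_perp_subspace: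
  assumes "W \<subseteq> carrier G"
  shows "subspace K (form_perp K G W) G"
  using assms
  by (intro subspaceI) (auto simp: form_perp_def form_add_left form_smult_left subset_iff)

lemma form_perp_antimono: "U \<subseteq> W \<Longrightarrow> form_perp K G W \<subseteq> form_perp K G U"
  by (auto simp: form_perp_def)

lemma subset_form_perp_perp:
  assumes "W \<subseteq> carrier G"
  shows "W \<subseteq> form_perp K G (form_perp K G W)"
  using assms by (auto simp: form_perp_def form_eq_zero_commute subset_iff)

lemma form_perp_span:
  assumes "S \<subseteq> carrier G"
  shows "form_perp K G (span S) = form_perp K G S"
proof
  show "form_perp K G (span S) \<subseteq> form_perp K G S"
    using in_own_span[OF assms] by (rule form_perp_antimono)
  have P: "form_perp K G S \<subseteq> carrier G" by (auto simp: form_perp_def)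
  \<comment> \<open>The double orthogonal of \<open>S\<close> is a subspace containing
    \<open>S\<close>, hence contains \<open>span S\<close>. Taking orthogonals once more gives the
    remaining inclusion, since \<open>form_perp K G S\<close> lies in its own double
    orthogonal.\<close>
  have "span S \<subseteq> form_perp K G (form_perp K G S)"
    using form_perp_subspace[OF P] subset_form_perp_perp[OF assms]
    by (simp add: span_is_subset subspace.submod)
  then show "form_perp K G S \<subseteq> form_perp K G (span S)"
    using subset_form_perp_perp[OF P] form_perp_antimono by blast
qed

text \<open>The substantial half of the double orthogonal theorem, by induction on \<open>S\<close>
  in place of a dimension count. The empty set is nondegeneracy. A new vector \<open>w\<close>
  either leaves the orthogonal unchanged, or some \<open>x\<close> orthogonal to \<open>S\<close>
  pairs with it to one; then a multiple of \<open>w\<close> moves \<open>v\<close> into the double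
  orthogonal of \<open>S\<close>.\<close>

lemma form_perp_perp_finite:
  assumes "finite S" "S \<subseteq> carrier G"
  shows "form_perp K G (form_perp K G S) \<subseteq> span S"
  using assms
proof (induction S)
  case empty
  have "u = \<zero>\<^bsub>G\<^esub>" if "u \<in> form_perp K G (form_perp K G {})" for u
    using that by (intro form_nondegenerate) (auto simp: form_perp_def)
  moreover have "\<zero>\<^bsub>G\<^esub> \<in> span {}"
    using span_is_subspace[of "{}"] by (intro subspaceD) auto
  ultimately show ?case by blast
next
  case (insert w S)
  then have S: "S \<subseteq> carrier G" and w: "w \<in> carrier G"
    and IH: "form_perp K G (form_perp K G S) \<subseteq> span S"
    by auto
  have mono: "span S \<subseteq> span (insert w S)" by (intro span_is_monotone) auto
  show ?case
  proof (cases "\<forall>x\<in>form_perp K G S. form G x w = \<zero>")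
    case True
    then have "form_perp K G (insert w S) = form_perp K G S"
      by (auto simp: form_perp_def)
    then show ?thesis using IH mono by simp
  next
    case False
    then obtain x0 where x0: "x0 \<in> form_perp K G S" "form G x0 w \<noteq> \<zero>" by blast
    have sub: "subspace K (form_perp K G S) G" using S by (rule form_perp_subspace)
    \<comment> \<open>Correcting by multiples of \<open>x\<close> and \<open>w\<close>, which are dual under the form, reduces to \<open>S\<close>.\<close>
    define x where "x = inv (form G x0 w) \<odot>\<^bsub>G\<^esub> x0"
    have x0c: "x0 \<in> carrier G" using x0 by (simp add: form_perp_def)
    have unit: "form G x0 w \<in> Units K" using x0 x0c w by (simp add: field_Units form_closed)
    have x: "x \<in> form_perp K G S" unfolding x_def using unit x0 subspaceD(4)[OF sub] by blast
    have xc: "x \<in> carrier G" using x by (simp add: form_perp_def)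
    have xw: "form G x w = \<one>"
      using unit x0c w by (simp add: x_def form_smult_left)
    have wx: "form G w x = \<ominus> \<one>" using form_antisym[OF w xc] xw by simp
    show ?thesis
    proof
      fix v assume v: "v \<in> form_perp K G (form_perp K G (insert w S))"
      then have vc: "v \<in> carrier G" by (simp add: form_perp_def)
      define v' where "v' = v \<oplus>\<^bsub>G\<^esub> form G v x \<odot>\<^bsub>G\<^esub> w"
      have v'c: "v' \<in> carrier G" using vc w xc by (simp add: v'_def form_closed)
      have "form G v' y = \<zero>" if y: "y \<in> form_perp K G S" for y
      proof -
        have yc: "y \<in> carrier G" using y by (simp add: form_perp_def)
        let ?y' = "y \<oplus>\<^bsub>G\<^esub> (\<ominus> form G y w) \<odot>\<^bsub>G\<^esub> x"
        have "?y' \<in> form_perp K G S"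
          using x y yc w by (intro subspaceD(3,4)[OF sub]) (auto simp: form_closed)
        moreover have "form G ?y' w = \<zero>"
          using xw xc yc w by (simp add: form_add_left form_smult_left form_closed R.r_neg)
        ultimately have "?y' \<in> form_perp K G (insert w S)" by (simp add: form_perp_def)
        then have "form G v ?y' = \<zero>" using v by (simp add: form_perp_def)
        \<comment> \<open>This expresses \<open>form G v y\<close> as \<open>form G y w\<close>
          times \<open>form G v x\<close>. By antisymmetry it cancels what the added multiple of
          \<open>w\<close> contributes to \<open>form G v' y\<close>.\<close>
        then have "form G v y \<oplus> (\<ominus> form G y w) \<otimes> form G v x = \<zero>"
          using vc xc yc w by (simp add: form_add_right form_smult_right form_closed)
        moreover have "form G v' y = form G v y \<oplus> form G v x \<otimes> form G w y"
          using vc xc yc w by (simp add: v'_def form_add_left form_smult_left form_closed)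
        ultimately show ?thesis
          using form_antisym[OF w yc] vc xc yc w by (simp add: form_closed R.m_comm)
      qed
      then have "v' \<in> span S" using IH v'c by (auto simp: form_perp_def)
      then have v': "v' \<in> span (insert w S)" using mono by blast
      have sub': "subspace K (span (insert w S)) G" using insert.prems by (rule span_is_subspace)
      have "w \<in> span (insert w S)" using in_own_span insert.prems by blast
      then have "\<ominus>\<^bsub>G\<^esub> (form G v x \<odot>\<^bsub>G\<^esub> w) \<in> span (insert w S)"
        using subspaceD(4,5)[OF sub'] vc xc by (simp add: form_closed)
      with v' have "v' \<oplus>\<^bsub>G\<^esub> \<ominus>\<^bsub>G\<^esub> (form G v x \<odot>\<^bsub>G\<^esub> w) \<in> span (insert w S)"
        using subspaceD(3)[OF sub'] by blast
      also have "v' \<oplus>\<^bsub>G\<^esub> \<ominus>\<^bsub>G\<^esub> (form G v x \<odot>\<^bsub>G\<^esub> w) = v"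
        using vc xc w by (simp add: v'_def form_closed M.a_assoc M.r_neg)
      finally show "v \<in> span (insert w S)" .
    qed
  qed
qed

lemma form_perp_perp:
  assumes "subspace K W G"
  shows "form_perp K G (form_perp K G W) = W"
proof
  have W: "W \<subseteq> carrier G" using assms by (rule subspaceD)
  show "W \<subseteq> form_perp K G (form_perp K G W)" using W by (rule subset_form_perp_perp)
  \<comment> \<open>\<open>W\<close> and its finite spanning set have the same orthogonal, so the
    finite case applies.\<close>
  obtain S where S: "finite S" "S \<subseteq> W" "span S = W"
    using subspace_finitely_spanned finite_dimensional assms .
  then show "form_perp K G (form_perp K G W) \<subseteq> W"
    using form_perp_perp_finite[of S] form_perp_span[of S] W by auto
qed

text \<open>For \<open>j\<close> in \<open>J\<close>, the cocycle identity expresses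
  \<open>form G (bracket G x y) j\<close> through the pairings of \<open>bracket G j x\<close> with
  \<open>y\<close> and of \<open>bracket G y j\<close> with \<open>x\<close>. Both brackets lie in
  the ideal \<open>J\<close>, so both pairings vanish.\<close>

lemma bracket_form_perp_closed:
  assumes J: "lie_ideal K J G" and x: "x \<in> form_perp K G J" and y: "y \<in> form_perp K G J"
  shows "bracket G x y \<in> form_perp K G J"
proof -
  have c: "x \<in> carrier G" "y \<in> carrier G" using x y by (auto simp: form_perp_def)
  have sub: "J \<subseteq> carrier G" using J by (auto simp: lie_ideal_def dest: subspaceD)
  have "form G (bracket G x y) j = \<zero>" if j: "j \<in> J" for j
  proof -
    have jc: "j \<in> carrier G" using j sub by blast
    have "bracket G j x \<in> J" "bracket G y j \<in> J" using lie_idealD J c j by blast+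
    then have "form G (bracket G j x) y = \<zero>" "form G (bracket G y j) x = \<zero>"
      using x y sub c form_eq_zero_commute by (auto simp: form_perp_def)
    then show ?thesis
      using form_cocycle[OF c jc] c jc by (simp add: form_closed bracket_closed)
  qed
  then show ?thesis using c by (simp add: form_perp_def bracket_closed)
qed

end

text \<open>The projection onto a symplectic reduction up to isomorphism. With \<open>J = 0\<close> this is an
  isomorphism of symplectic Lie algebras, which covers the last step to the base. That \<open>J\<close> is the
  whole kernel need not be assumed, since \<open>p\<close> preserves the form and \<open>J\<^sup>\<bottom>\<^sup>\<bottom> = J\<close>.\<close>

locale symplectic_reduction_map = symplectic_lie_algebra K G + H: vectorspace K H
  for K :: "('a, 'k) ring_scheme" (structure)
    and G :: "('a, 'b, 'c) symplectic_record_scheme"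
    and H :: "('a, 'd, 'e) symplectic_record_scheme" +
  fixes J p
  assumes isotropic_ideal: "isotropic_ideal K J G"
    and linear: "linear_map K (G\<lparr>carrier := form_perp K G J\<rparr>) H p"
    and onto: "p ` form_perp K G J = carrier H"
    and p_zero: "x \<in> J \<Longrightarrow> p x = \<zero>\<^bsub>H\<^esub>"
    and p_bracket: "\<lbrakk>x \<in> form_perp K G J; y \<in> form_perp K G J\<rbrakk> \<Longrightarrow>
      p (bracket G x y) = bracket H (p x) (p y)"
    and p_form: "\<lbrakk>x \<in> form_perp K G J; y \<in> form_perp K G J\<rbrakk> \<Longrightarrow>
      form H (p x) (p y) = form G x y"
begin

section \<open>Closure of the orthogonal and linearity of the projection\<close>

abbreviation P where "P \<equiv> form_perp K G J"

lemma J_ideal: "lie_ideal K J G" and J_subspace: "subspace K J G" and J_subset_P: "J \<subseteq> P"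
  using isotropic_ideal by (auto simp: isotropic_ideal_def lie_ideal_def isotropic_def)

lemma J_carrier: "J \<subseteq> carrier G"
  using J_subspace by (rule subspaceD)

lemma P_subspace: "subspace K P G"
  using J_carrier by (rule form_perp_subspace)

lemma P_carrier [simp]: "x \<in> P \<Longrightarrow> x \<in> carrier G"
  by (simp add: form_perp_def)

lemma P_closed [simp]:
  "\<zero>\<^bsub>G\<^esub> \<in> P"
  "\<lbrakk>x \<in> P; y \<in> P\<rbrakk> \<Longrightarrow> x \<oplus>\<^bsub>G\<^esub> y \<in> P"
  "\<lbrakk>a \<in> carrier K; x \<in> P\<rbrakk> \<Longrightarrow> a \<odot>\<^bsub>G\<^esub> x \<in> P"
  "x \<in> P \<Longrightarrow> \<ominus>\<^bsub>G\<^esub> x \<in> P"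
  "\<lbrakk>x \<in> P; y \<in> P\<rbrakk> \<Longrightarrow> bracket G x y \<in> P"
  by (fact subspaceD[OF P_subspace] bracket_form_perp_closed[OF J_ideal])+

lemma
  shows p_closed [simp]: "x \<in> P \<Longrightarrow> p x \<in> carrier H"
    and p_add: "\<lbrakk>x \<in> P; y \<in> P\<rbrakk> \<Longrightarrow> p (x \<oplus>\<^bsub>G\<^esub> y) = p x \<oplus>\<^bsub>H\<^esub> p y"
    and p_smult: "\<lbrakk>a \<in> carrier K; x \<in> P\<rbrakk> \<Longrightarrow> p (a \<odot>\<^bsub>G\<^esub> x) = a \<odot>\<^bsub>H\<^esub> p x"
proof -
  interpret p: linear_map K "G\<lparr>carrier := P\<rparr>" H p by (rule linear)
  show "x \<in> P \<Longrightarrow> p x \<in> carrier H"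
    "\<lbrakk>x \<in> P; y \<in> P\<rbrakk> \<Longrightarrow> p (x \<oplus>\<^bsub>G\<^esub> y) = p x \<oplus>\<^bsub>H\<^esub> p y"
    "\<lbrakk>a \<in> carrier K; x \<in> P\<rbrakk> \<Longrightarrow> p (a \<odot>\<^bsub>G\<^esub> x) = a \<odot>\<^bsub>H\<^esub> p x"
    using p.T_im[of x] p.T_add[of x y] p.T_smult[of a x] by simp_all
qed

lemma p_zero_vector: "p \<zero>\<^bsub>G\<^esub> = \<zero>\<^bsub>H\<^esub>"
  using subspaceD(2)[OF J_subspace] by (rule p_zero)

lemma H_cases:
  assumes "u \<in> carrier H"
  obtains x where "x \<in> P" "u = p x"
  using assms onto by blast

section \<open>The reduction is again a symplectic Lie algebra\<close>

lemma H_fin_dim: "H.fin_dim"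
proof -
  interpret p: linear_map K "G\<lparr>carrier := P\<rparr>" H p by (rule linear)
  show ?thesis
    using p.surj_fin_dim fin_dim_subspace[OF finite_dimensional P_subspace] onto by simp
qed

text \<open>Oriented to pull operations of \<open>H\<close> back under \<open>p\<close>. Once
  \<open>H_cases\<close> writes elements of \<open>H\<close> as images, each axiom of
  \<open>H\<close> becomes the image of the same axiom in \<open>G\<close>.\<close>

lemmas p_hom = p_add [symmetric] p_smult [symmetric] p_bracket [symmetric]
  p_zero_vector [symmetric]

lemma H_lie_algebra: "lie_algebra K H"
  by unfold_locales
    (auto simp: char_0 H_fin_dim p_hom bracket_add_left bracket_add_right bracket_smult_left
      bracket_smult_right bracket_self jacobi elim!: H_cases)

lemma H_symplectic: "symplectic_lie_algebra K H"
proof -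
  interpret H: lie_algebra K H by (rule H_lie_algebra)
  \<comment> \<open>If \<open>p x\<close> is orthogonal to all of \<open>H\<close>, then
    \<open>x\<close> is orthogonal to \<open>P\<close>, so it lies in the double orthogonal of
    \<open>J\<close>, which is \<open>J\<close>, and \<open>p\<close> kills it.\<close>
  have nondeg: "p x = \<zero>\<^bsub>H\<^esub>" if "x \<in> P" "\<And>v. v \<in> carrier H \<Longrightarrow> form H (p x) v = \<zero>" for x
  proof -
    have "form G x y = \<zero>" if "y \<in> P" for y
      using p_form[OF \<open>x \<in> P\<close> that] \<open>\<And>v. v \<in> carrier H \<Longrightarrow> form H (p x) v = \<zero>\<close> that by simp
    then have "x \<in> form_perp K G P"
      using \<open>x \<in> P\<close> by (simp add: form_perp_def[of K G P])
    then show ?thesis using form_perp_perp[OF J_subspace] by (simp add: p_zero)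
  qed
  show ?thesis
  proof unfold_locales
    fix u assume "u \<in> carrier H" "\<And>v. v \<in> carrier H \<Longrightarrow> form H u v = \<zero>"
    then show "u = \<zero>\<^bsub>H\<^esub>" using nondeg by (auto elim!: H_cases)
  qed (auto simp: p_hom p_form form_closed form_add_left form_add_right form_smult_left
      form_smult_right form_alternating form_cocycle elim!: H_cases)
qed

section \<open>Transport of Lagrangian subalgebras along one reduction\<close>

lemma lagrangian_image:
  assumes "lagrangian_subalgebra K L G"
  shows "lagrangian_subalgebra K (p ` (L \<inter> P)) H"
proof -
  have L: "subspace K L G" "L = form_perp K G L"
    "\<And>x y. \<lbrakk>x \<in> L; y \<in> L\<rbrakk> \<Longrightarrow> bracket G x y \<in> L"
    using assms
    by (auto simp: lagrangian_subalgebra_def lie_subalgebra_def lagrangian_def)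
  have LJ: "subspace K (subspace_sum L J) G" (is "subspace K ?S G")
    using L(1) J_subspace by (rule sum_is_subspace)
  \<comment> \<open>Both summands lie in the sum, so its orthogonal lies in those of
    \<open>L\<close> and \<open>J\<close>, which are \<open>L\<close> and \<open>P\<close>.\<close>
  have perp_S: "form_perp K G ?S \<subseteq> L \<inter> P"
    using in_sum_vs[OF L(1) J_subspace] in_sum_vs[OF J_subspace L(1)]
      vsum_comm[OF L(1) J_subspace] L(2) form_perp_antimono[of L ?S] form_perp_antimono[of J ?S]
    by blast
  have sub: "subspace K (p ` (L \<inter> P)) H"
  proof (rule H.subspaceI)
    show "p ` (L \<inter> P) \<subseteq> carrier H" by auto
    show "\<zero>\<^bsub>H\<^esub> \<in> p ` (L \<inter> P)"
      using p_zero_vector subspaceD(2)[OF L(1)] by (metis IntI P_closed(1) imageI)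
  qed (use subspaceD(3,4)[OF L(1)] in \<open>auto simp: p_hom intro!: imageI\<close>)
  have "bracket H x y \<in> p ` (L \<inter> P)" if "x \<in> p ` (L \<inter> P)" "y \<in> p ` (L \<inter> P)" for x y
    using that L(3) by (auto simp: p_hom intro!: imageI)
  moreover have "p ` (L \<inter> P) = form_perp K H (p ` (L \<inter> P))"
  proof
    have "form G x y = \<zero>" if "x \<in> L" "y \<in> L" for x y
      using that L(2) form_perpD by metis
    then show "p ` (L \<inter> P) \<subseteq> form_perp K H (p ` (L \<inter> P))"
      by (auto simp: form_perp_def[of K H] p_form)
  next
    show "form_perp K H (p ` (L \<inter> P)) \<subseteq> p ` (L \<inter> P)"
    proof
      fix u assume u: "u \<in> form_perp K H (p ` (L \<inter> P))"
      then obtain v where v: "v \<in> P" "u = p v"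
        by (auto simp: form_perp_def[of K H] elim: H_cases)
      have "form G v x = \<zero>" if "x \<in> form_perp K G ?S" for x
      proof -
        have x: "x \<in> L" "x \<in> P" using that perp_S by auto
        then have "form H u (p x) = \<zero>" using form_perpD[OF u] by blast
        then show ?thesis using v x p_form by simp
      qed
      then have "v \<in> form_perp K G (form_perp K G ?S)"
        using v P_carrier by (simp add: form_perp_def[of K G "form_perp K G ?S"])
      then have "v \<in> ?S" using form_perp_perp[OF LJ] by simp
      then obtain l j where lj: "l \<in> L" "j \<in> J" "v = l \<oplus>\<^bsub>G\<^esub> j"
        by (auto simp: submodule_sum_def)
      have lc: "l \<in> carrier G" and jc: "j \<in> carrier G"
        using lj subspaceD(1)[OF L(1)] J_carrier by auto
      \<comment> \<open>The component \<open>l\<close> stays in \<open>P\<close> because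
        \<open>J \<subseteq> P\<close> by isotropy; it can therefore replace \<open>v\<close> as a
        preimage of \<open>u\<close>.\<close>
      have "l = v \<oplus>\<^bsub>G\<^esub> \<ominus>\<^bsub>G\<^esub> j"
        using lc jc lj(3) by (simp add: M.a_assoc M.r_neg)
      moreover have "v \<oplus>\<^bsub>G\<^esub> \<ominus>\<^bsub>G\<^esub> j \<in> P"
        using v(1) lj(2) J_subset_P by auto
      ultimately have l: "l \<in> P" by (rule ssubst)
      have "p v = p l"
        using lj l J_subset_P p_add[of l j] p_zero[of j] by auto
      then show "u \<in> p ` (L \<inter> P)" using v l lj by auto
    qed
  qed
  ultimately show ?thesis
    using sub by (simp add: lagrangian_subalgebra_def lie_subalgebra_def lagrangian_def)
qed

lemma lagrangian_preimage:
  assumes "lagrangian_subalgebra K L H"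
  shows "lagrangian_subalgebra K {x \<in> P. p x \<in> L} G" (is "lagrangian_subalgebra K ?L G")
proof -
  have L: "subspace K L H" "L = form_perp K H L"
    "\<And>x y. \<lbrakk>x \<in> L; y \<in> L\<rbrakk> \<Longrightarrow> bracket H x y \<in> L"
    using assms
    by (auto simp: lagrangian_subalgebra_def lie_subalgebra_def lagrangian_def)
  have sub: "subspace K ?L G"
    using H.subspaceD[OF L(1)] p_zero_vector
    by (intro subspaceI) (auto simp: p_add p_smult)
  have "bracket G x y \<in> ?L" if "x \<in> ?L" "y \<in> ?L" for x y
    using that L(3) by (simp add: p_bracket)
  moreover have "?L = form_perp K G ?L"
  proof
    have "form H x y = \<zero>" if "x \<in> L" "y \<in> L" for x y
      using that L(2) form_perpD by metis
    then show "?L \<subseteq> form_perp K G ?L"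
      by (auto simp: form_perp_def[of K G ?L] simp flip: p_form)
  next
    have "J \<subseteq> ?L"
      using J_subset_P p_zero H.subspaceD(2)[OF L(1)] by auto
    then have P: "form_perp K G ?L \<subseteq> P" by (rule form_perp_antimono)
    show "form_perp K G ?L \<subseteq> ?L"
    proof
      fix x assume x: "x \<in> form_perp K G ?L"
      then have xP: "x \<in> P" using P by blast
      \<comment> \<open>Surjectivity of \<open>p\<close> lifts \<open>y\<close> to some
        \<open>z\<close> in the preimage of \<open>L\<close>, to which \<open>x\<close> is
        orthogonal by assumption.\<close>
      have "form H (p x) y = \<zero>" if y: "y \<in> L" for y
      proof -
        obtain z where "z \<in> P" "y = p z"
          using y H.subspaceD(1)[OF L(1)] onto by blast
        then show ?thesis using x xP y by (simp add: p_form form_perp_def[of K G ?L])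
      qed
      then have "p x \<in> form_perp K H L" using xP by (simp add: form_perp_def[of K H])
      then show "x \<in> ?L" using L(2) xP by auto
    qed
  qed
  ultimately show ?thesis
    using sub by (simp add: lagrangian_subalgebra_def lie_subalgebra_def lagrangian_def)
qed

lemma lagrangian_subalgebra_iff:
  "(\<exists>L. lagrangian_subalgebra K L G) \<longleftrightarrow> (\<exists>L. lagrangian_subalgebra K L H)"
  using lagrangian_image lagrangian_preimage by blast

end

section \<open>Quotients and isomorphisms as reduction maps\<close>

text \<open>Replaces cosets by a map on the orthogonal of \<open>J\<close>. The work lies in showing
  that the operations of \<open>symplectic_quotient\<close> do not depend on
  representatives.\<close>

lemma (in symplectic_lie_algebra) symplectic_quotient_iso_reduction_map:
  assumes J: "isotropic_ideal K J G"
    and f: "linear_map K (symplectic_quotient K G J) H f"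
      "bij_betw f (carrier (symplectic_quotient K G J)) (carrier H)"
      "\<And>x y. \<lbrakk>x \<in> carrier (symplectic_quotient K G J); y \<in> carrier (symplectic_quotient K G J)\<rbrakk> \<Longrightarrow>
        f (bracket (symplectic_quotient K G J) x y) = bracket H (f x) (f y)"
      "\<And>x y. \<lbrakk>x \<in> carrier (symplectic_quotient K G J); y \<in> carrier (symplectic_quotient K G J)\<rbrakk> \<Longrightarrow>
        form H (f x) (f y) = form (symplectic_quotient K G J) x y"
  shows "symplectic_reduction_map K G H J (\<lambda>x. f (J +>\<^bsub>G\<^esub> x))"
proof -
  let ?Q = "symplectic_quotient K G J" and ?P = "form_perp K G J"
  have ideal: "lie_ideal K J G" and sub: "subspace K J G" and JP: "J \<subseteq> ?P"
    using J by (auto simp: isotropic_ideal_def lie_ideal_def isotropic_def)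
  note J_closed = subspaceD[OF sub]
  have P: "subspace K ?P G" using J_closed(1) by (rule form_perp_subspace)
  note P_closed = subspaceD[OF P]
  have Pc: "x \<in> carrier G" if "x \<in> ?P" for x using that P_closed(1) by blast
  have Jc: "x \<in> carrier G" if "x \<in> J" for x using that J_closed(1) by blast
  interpret J: abelian_subgroup J G
  proof (intro abelian_subgroupI3 additive_subgroupI subgroup.intro)
    show "abelian_group G" ..
  qed (use J_closed Jc in \<open>auto simp flip: a_inv_def\<close>)
  interpret f: linear_map K ?Q H f by (rule f(1))
  have self: "x \<in> J +>\<^bsub>G\<^esub> x" if "x \<in> ?P" for x
    using that Pc by (intro J.a_rcos_self) auto
  have rep: "\<exists>j\<in>J. x = j \<oplus>\<^bsub>G\<^esub> y" if "x \<in> J +>\<^bsub>G\<^esub> y" for x y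
    using that by (auto simp: a_r_coset_def')
  have eq: "J +>\<^bsub>G\<^esub> (j \<oplus>\<^bsub>G\<^esub> y) = J +>\<^bsub>G\<^esub> y" if "j \<in> J" "y \<in> carrier G" for j y
    using that Jc J.a_rcos_const[of j] by (metis J.a_subset a_coset_add_assoc)
  have carrier: "carrier ?Q = (\<lambda>x. J +>\<^bsub>G\<^esub> x) ` ?P"
    by (auto simp: symplectic_quotient_def A_RCOSETS_def' a_r_coset_def')
  have zero: "J +>\<^bsub>G\<^esub> x = \<zero>\<^bsub>?Q\<^esub>" if "x \<in> J" for x
    using J.a_rcos_const that by (simp add: symplectic_quotient_def)
  have add: "(J +>\<^bsub>G\<^esub> x) \<oplus>\<^bsub>?Q\<^esub> (J +>\<^bsub>G\<^esub> y) = J +>\<^bsub>G\<^esub> (x \<oplus>\<^bsub>G\<^esub> y)" if "x \<in> ?P" "y \<in> ?P" for x y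
    using J.a_rcos_sum Pc that by (simp add: symplectic_quotient_def)
  have smult: "a \<odot>\<^bsub>?Q\<^esub> (J +>\<^bsub>G\<^esub> x) = J +>\<^bsub>G\<^esub> (a \<odot>\<^bsub>G\<^esub> x)" if a: "a \<in> carrier K" and x: "x \<in> ?P" for a x
  proof -
    have "J +>\<^bsub>G\<^esub> (a \<odot>\<^bsub>G\<^esub> y) = J +>\<^bsub>G\<^esub> (a \<odot>\<^bsub>G\<^esub> x)" if y: "y \<in> J +>\<^bsub>G\<^esub> x" for y
    proof -
      obtain j where "j \<in> J" "y = j \<oplus>\<^bsub>G\<^esub> x" using rep y by blast
      then show ?thesis using a Pc[OF x] Jc J_closed(4) eq by (simp add: smult_r_distr)
    qed
    \<comment> \<open>All members of the union coincide, and the index set is inhabited by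
      \<open>x\<close>, so the union is a single coset.\<close>
    then have "(\<Union>y\<in>J +>\<^bsub>G\<^esub> x. J +>\<^bsub>G\<^esub> (a \<odot>\<^bsub>G\<^esub> y)) = J +>\<^bsub>G\<^esub> (a \<odot>\<^bsub>G\<^esub> x)"
      using self[OF x] by blast
    then show ?thesis by (simp add: symplectic_quotient_def)
  qed
  have bracket: "bracket ?Q (J +>\<^bsub>G\<^esub> x) (J +>\<^bsub>G\<^esub> y) = J +>\<^bsub>G\<^esub> bracket G x y"
    if x: "x \<in> ?P" and y: "y \<in> ?P" for x y
  proof -
    have "J +>\<^bsub>G\<^esub> bracket G x' y' = J +>\<^bsub>G\<^esub> bracket G x y"
      if x': "x' \<in> J +>\<^bsub>G\<^esub> x" and y': "y' \<in> J +>\<^bsub>G\<^esub> y" for x' y'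
    proof -
      obtain j j' where j: "j \<in> J" "x' = j \<oplus>\<^bsub>G\<^esub> x" "j' \<in> J" "y' = j' \<oplus>\<^bsub>G\<^esub> y"
        using rep x' y' by metis
      \<comment> \<open>Changing both representatives adds two brackets having a factor in
        \<open>J\<close>, one on each side; the two-sided ideal property absorbs them.\<close>
      have "bracket G x' y' = bracket G j y' \<oplus>\<^bsub>G\<^esub> (bracket G x j' \<oplus>\<^bsub>G\<^esub> bracket G x y)"
        using j Jc Pc x y bracket_add_left[of j x y'] bracket_add_right[of x j' y] by simp
      moreover have "bracket G j y' \<in> J" "bracket G x j' \<in> J"
        using lie_idealD[OF ideal] j Jc Pc x y by auto
      ultimately show ?thesis
        using eq Jc Pc x y by (simp add: bracket_closed)
    qed
    then have "(\<Union>x'\<in>J +>\<^bsub>G\<^esub> x. \<Union>y'\<in>J +>\<^bsub>G\<^esub> y. J +>\<^bsub>G\<^esub> bracket G x' y') = J +>\<^bsub>G\<^esub> bracket G x y"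
      using self[OF x] self[OF y] by blast
    then show ?thesis by (simp add: symplectic_quotient_def)
  qed
  have form: "form ?Q (J +>\<^bsub>G\<^esub> x) (J +>\<^bsub>G\<^esub> y) = form G x y"
    if x: "x \<in> ?P" and y: "y \<in> ?P" for x y
  proof -
    have "form G x' y' = form G x y"
      if x': "x' \<in> J +>\<^bsub>G\<^esub> x" and y': "y' \<in> J +>\<^bsub>G\<^esub> y" for x' y'
    proof -
      obtain j j' where j: "j \<in> J" "x' = j \<oplus>\<^bsub>G\<^esub> x" "j' \<in> J" "y' = j' \<oplus>\<^bsub>G\<^esub> y"
        using rep x' y' by metis
      \<comment> \<open>The mixed terms vanish because \<open>x\<close> and \<open>y\<close> are
        orthogonal to \<open>J\<close>, the last one because \<open>J\<close> is isotropic.\<close>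
      have "form G x j' = \<zero>" "form G y j = \<zero>" "form G j j' = \<zero>"
        using x y j JP by (auto simp: form_perp_def)
      then show ?thesis
        using j Jc Pc x y form_eq_zero_commute[of y j]
        by (simp add: form_add_left form_add_right form_closed)
    qed
    then have "{form G x' y' |x' y'. x' \<in> J +>\<^bsub>G\<^esub> x \<and> y' \<in> J +>\<^bsub>G\<^esub> y} = {form G x y}"
      using self[OF x] self[OF y] by blast
    then show ?thesis by (simp add: symplectic_quotient_def)
  qed
  have "linear_map K (G\<lparr>carrier := ?P\<rparr>) H (\<lambda>x. f (J +>\<^bsub>G\<^esub> x))"
  proof -
    interpret P: vectorspace K "G\<lparr>carrier := ?P\<rparr>" using P by (rule subspace_is_vs)
    show ?thesis
      using f.T_im f.T_add f.T_smult
      by unfold_locales (auto simp: module_hom_def carrier simp flip: add smult)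
  qed
  moreover have "(\<lambda>x. f (J +>\<^bsub>G\<^esub> x)) ` ?P = carrier H"
    using f(2) by (simp add: bij_betw_def carrier image_image)
  ultimately show ?thesis
  proof (intro symplectic_reduction_map.intro symplectic_reduction_map_axioms.intro
      symplectic_lie_algebra_axioms f.W.vectorspace_axioms J)
    show "f (J +>\<^bsub>G\<^esub> x) = \<zero>\<^bsub>H\<^esub>" if "x \<in> J" for x
      using zero[OF that] f.T0_is_0 by (rule ssubst)
    fix x y assume xy: "x \<in> ?P" "y \<in> ?P"
    then have Q: "J +>\<^bsub>G\<^esub> x \<in> carrier ?Q" "J +>\<^bsub>G\<^esub> y \<in> carrier ?Q"
      unfolding carrier by blast+
    show "f (J +>\<^bsub>G\<^esub> bracket G x y) = bracket H (f (J +>\<^bsub>G\<^esub> x)) (f (J +>\<^bsub>G\<^esub> y))"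
      using f(3)[OF Q] bracket[OF xy] by simp
    show "form H (f (J +>\<^bsub>G\<^esub> x)) (f (J +>\<^bsub>G\<^esub> y)) = form G x y"
      using f(4)[OF Q] form[OF xy] by simp
  qed
qed

text \<open>The orthogonal of the zero ideal is all of \<open>G\<close>, so \<open>f\<close> is
  already defined on the required domain.\<close>

lemma (in symplectic_lie_algebra) symplectic_iso_reduction_map:
  assumes f: "linear_map K G H f" "bij_betw f (carrier G) (carrier H)"
      "\<And>x y. \<lbrakk>x \<in> carrier G; y \<in> carrier G\<rbrakk> \<Longrightarrow> f (bracket G x y) = bracket H (f x) (f y)"
      "\<And>x y. \<lbrakk>x \<in> carrier G; y \<in> carrier G\<rbrakk> \<Longrightarrow> form H (f x) (f y) = form G x y"
  shows "symplectic_reduction_map K G H {\<zero>\<^bsub>G\<^esub>} f"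
proof -
  interpret f: linear_map K G H f by (rule f(1))
  have perp: "form_perp K G {\<zero>\<^bsub>G\<^esub>} = carrier G" by (auto simp: form_perp_def)
  have "subspace K {\<zero>\<^bsub>G\<^esub>} G" by (intro subspaceI) auto
  moreover have "bracket G x \<zero>\<^bsub>G\<^esub> = \<zero>\<^bsub>G\<^esub>" if "x \<in> carrier G" for x
    using bracket_smult_right[of \<zero> x "\<zero>\<^bsub>G\<^esub>"] that by (simp add: bracket_closed)
  ultimately have "isotropic_ideal K {\<zero>\<^bsub>G\<^esub>} G"
    by (simp add: isotropic_ideal_def lie_ideal_def isotropic_def perp)
  then show ?thesis
    using f f.W.vectorspace_axioms symplectic_lie_algebra_axioms
    by (intro symplectic_reduction_map.intro symplectic_reduction_map_axioms.intro)
      (simp_all add: perp bij_betw_def)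
qed

section \<open>Iteration along the sequence of reductions\<close>

lemma symplectic_reduction_lagrangian_subalgebra:
  assumes "symplectic_lie_algebra K G" "symplectic_reduction K G H"
  shows "symplectic_lie_algebra K H"
    and "(\<exists>L. lagrangian_subalgebra K L G) \<longleftrightarrow> (\<exists>L. lagrangian_subalgebra K L H)"
proof -
  interpret symplectic_lie_algebra K G by (rule assms(1))
  obtain J f where "isotropic_ideal K J G"
      "linear_map K (symplectic_quotient K G J) H f"
      "bij_betw f (carrier (symplectic_quotient K G J)) (carrier H)"
      "\<forall>x\<in>carrier (symplectic_quotient K G J). \<forall>y\<in>carrier (symplectic_quotient K G J).
        f (bracket (symplectic_quotient K G J) x y) = bracket H (f x) (f y)"
      "\<forall>x\<in>carrier (symplectic_quotient K G J). \<forall>y\<in>carrier (symplectic_quotient K G J).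
        form H (f x) (f y) = form (symplectic_quotient K G J) x y"
    using assms(2) unfolding symplectic_reduction_def symplectic_iso_def by blast
  then have "symplectic_reduction_map K G H J (\<lambda>x. f (J +>\<^bsub>G\<^esub> x))"
    by (intro symplectic_quotient_iso_reduction_map) auto
  then interpret red: symplectic_reduction_map K G H J "\<lambda>x. f (J +>\<^bsub>G\<^esub> x)" .
   show "symplectic_lie_algebra K H"
    "(\<exists>L. lagrangian_subalgebra K L G) \<longleftrightarrow> (\<exists>L. lagrangian_subalgebra K L H)"
    by (fact red.H_symplectic red.lagrangian_subalgebra_iff)+
qed

lemma symplectic_iso_lagrangian_subalgebra_iff:
  assumes "symplectic_lie_algebra K G" "symplectic_iso K G H"
  shows "(\<exists>L. lagrangian_subalgebra K L G) \<longleftrightarrow> (\<exists>L. lagrangian_subalgebra K L H)"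
proof -
  obtain f where "symplectic_reduction_map K G H {\<zero>\<^bsub>G\<^esub>} f"
    using assms symplectic_lie_algebra.symplectic_iso_reduction_map
    unfolding symplectic_iso_def by metis
  then show ?thesis by (rule symplectic_reduction_map.lagrangian_subalgebra_iff)
qed

theorem proposition3p12:
  fixes K :: "('a, 'k) ring_scheme"
    and G :: "('a, 'b) symplectic_record"
    and B :: "('a, 'd) symplectic_record"
  assumes "symplectic_lie_algebra K G"
    and "irreducible_symplectic_base K G B"
  shows "(\<exists>L. lagrangian_subalgebra K L G) \<longleftrightarrow> (\<exists>L. lagrangian_subalgebra K L B)"
proof -
  obtain H where H: "(symplectic_reduction K)\<^sup>*\<^sup>* G H" "symplectic_iso K H B"
    using assms(2) by (auto simp: irreducible_symplectic_base_def)
  \<comment> \<open>The induction carries symplecticity along with the equivalence, since every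
    reduction step requires it of its source.\<close>
  from H(1) have "symplectic_lie_algebra K H \<and>
      ((\<exists>L. lagrangian_subalgebra K L G) \<longleftrightarrow> (\<exists>L. lagrangian_subalgebra K L H))"
    by (induction rule: rtranclp_induct) (use assms(1) symplectic_reduction_lagrangian_subalgebra in blast)+
  \<comment> \<open>\<open>H\<close> lives in the type of \<open>G\<close>; the isomorphism passes
    to \<open>B\<close>, whose elements may have another type.\<close>
  then show ?thesis
    using symplectic_iso_lagrangian_subalgebra_iff H(2) by blast
qed

end
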